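(* Let $K$ be a field, let $\mathcal{C}$ be a clutter and let $\mathcal{C}'$ be a parallelization of $\mathcal{C}$. If the edge ideal $I(\mathcal{C})$ is normal, then the edge ideal $I(\mathcal{C}')$ is normal.
   Context: A clutter $\mathcal{C}$ with finite vertex set $V(\mathcal{C})=X=\{x_1,\ldots,x_n\}$ is a family $E(\mathcal{C})$ of subsets of $X$ (edges), none of which is included in another. Standing assumption on the initial clutter $\mathcal{C}$: $n\geq 1$ and each vertex lies in at least one edge (so all edges are nonempty). The vertices are identified with indeterminates. The edge ideal $I(\mathcal{C})$ is the ideal of the polynomial ring $K[V(\mathcal{C})]$ generated by the square-free monomials $\prod_{x_i\in e}x_i$, $e\in E(\mathcal{C})$ (the zero ideal if there are no edges). Duplicating a vertex $x_i$ means extending the vertex set by a new vertex $x_i'$ and replacing $E(\mathcal{C})$ by $E(\mathcal{C})\cup\{(e\setminus\{x_i\})\cup\{x_i'\} \mid x_i\in e\in E(\mathcal{C})\}$. Deleting a vertex $x_i$ means removing $x_i$ from the vertex set and removing all edges containing $x_i$. A parallelization of $\mathcal{C}$ is a clutter obtained from $\mathcal{C}$ by a sequence of deletions and duplications of vertices. For a monomial ideal $I$ of a polynomial ring $R$ over $K$, the integral closure of $I^i$ is $\overline{I^i}=(\{x^a\in R \mid \exists\, p\geq 1;\ (x^a)^p\in I^{pi}\})$, where $x^a$ ranges over the monomials of $R$. The ideal $I$ is called normal if $I^i=\overline{I^i}$ for all $i\geq 1$. *)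

theory Defs
  imports "HOL-Algebra.Ideal_Product" "HOL-Library.Poly_Mapping"
begin

section \<open>Clutters and parallelizations\<close>

record 'v clutter =
  verts :: "'v set"
  edges :: "'v set set"

definition is_clutter :: "'v clutter \<Rightarrow> bool" where
  "is_clutter C \<longleftrightarrow>
     finite (verts C) \<and> edges C \<subseteq> Pow (verts C) \<and>
     (\<forall>e\<in>edges C. \<forall>f\<in>edges C. e \<subseteq> f \<longrightarrow> e = f)"

definition del_vertex :: "'v clutter \<Rightarrow> 'v \<Rightarrow> 'v clutter" where
  "del_vertex C x = \<lparr>verts = verts C - {x}, edges = {e \<in> edges C. x \<notin> e}\<rparr>"

definition dup_vertex :: "'v clutter \<Rightarrow> 'v \<Rightarrow> 'v \<Rightarrow> 'v clutter" where
  "dup_vertex C x x' =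
     \<lparr>verts = insert x' (verts C),
      edges = edges C \<union> {insert x' (e - {x}) | e. e \<in> edges C \<and> x \<in> e}\<rparr>"

text \<open>The copy \<open>x'\<close> is any name outside the current vertex set, so a previously deleted
  vertex may be reused as a copy.\<close>

inductive parallelization :: "'v clutter \<Rightarrow> 'v clutter \<Rightarrow> bool" for C where
  refl: "parallelization C C"
| del: "parallelization C D \<Longrightarrow> x \<in> verts D \<Longrightarrow> parallelization C (del_vertex D x)"
| dup: "parallelization C D \<Longrightarrow> x \<in> verts D \<Longrightarrow> x' \<notin> verts D \<Longrightarrow>
          parallelization C (dup_vertex D x x')"

lemma parallelization_is_clutter:
  assumes "parallelization C D" "is_clutter C"
  shows "is_clutter D"
  using assms
proof (induction rule: parallelization.induct)
  case refl
  then show ?case .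
next
  case (del D x)
  then show ?case by (auto simp: is_clutter_def del_vertex_def)
next
  case (dup D x x')
  then have cl: "is_clutter D" by blast
  have sub: "e \<subseteq> verts D" if "e \<in> edges D" for e
    using cl that by (auto simp: is_clutter_def)
  have anti: "e = f" if "e \<in> edges D" "f \<in> edges D" "e \<subseteq> f" for e f
    using cl that by (auto simp: is_clutter_def)
  have "e = f" if e: "e \<in> edges (dup_vertex D x x')" and f: "f \<in> edges (dup_vertex D x x')"
    and ef: "e \<subseteq> f" for e f
  proof -
    consider "e \<in> edges D" "f \<in> edges D"
      | f' where "e \<in> edges D" "f' \<in> edges D" "x \<in> f'" "f = insert x' (f' - {x})"
      | e' where "f \<in> edges D" "e = insert x' (e' - {x})"
      | e' f' where "e' \<in> edges D" "x \<in> e'" "e = insert x' (e' - {x})"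
          "f' \<in> edges D" "x \<in> f'" "f = insert x' (f' - {x})"
      using e f by (auto simp: dup_vertex_def)
    then show ?thesis
    proof cases
      case 1
      then show ?thesis using anti ef by blast
    next
      case 2
      then have "e \<subseteq> f' - {x}" using sub[of e] ef dup.hyps by auto
      then show ?thesis using anti[of e f'] 2 by blast
    next
      case 3
      then show ?thesis using sub[of f] ef dup.hyps by auto
    next
      case 4
      then have "e' \<subseteq> f'" using sub[of e'] sub[of f'] ef dup.hyps by auto
      then show ?thesis using anti[of e' f'] 4 by blast
    qed
  qed
  then show ?case using cl dup.hyps by (auto simp: is_clutter_def dup_vertex_def)
qed


section \<open>Polynomial rings over a field with a prescribed set of variables\<close>

text \<open>A polynomial over \<open>'k\<close> with variables in \<open>'v\<close> maps exponent vectors (finitely supported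
  functions \<open>'v \<Rightarrow> nat\<close>) to coefficients, almost all zero. \<open>mpoly_ring V\<close> is the polynomial
  ring over \<open>'k\<close> whose variables are exactly the elements of \<open>V\<close>.\<close>

type_synonym ('v, 'k) mpoly = "('v \<Rightarrow>\<^sub>0 nat) \<Rightarrow>\<^sub>0 'k"

definition mpoly_ring :: "'v set \<Rightarrow> ('v, 'k::field) mpoly ring" where
  "mpoly_ring V =
     \<lparr>carrier = {p. \<forall>a \<in> Poly_Mapping.keys p. Poly_Mapping.keys a \<subseteq> V},
      mult = (*), one = 1, zero = 0, add = (+)\<rparr>"

definition mpoly_var :: "'v \<Rightarrow> ('v, 'k::field) mpoly" where
  "mpoly_var x = Poly_Mapping.single (Poly_Mapping.single x 1) 1"

definition monomials :: "'v set \<Rightarrow> ('v, 'k::field) mpoly set" where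
  "monomials V = {Poly_Mapping.single a 1 | a. Poly_Mapping.keys a \<subseteq> V}"

lemma cring_mpoly_ring: "cring (mpoly_ring V :: ('v, 'k::field) mpoly ring)"
proof (rule cringI)
  let ?R = "mpoly_ring V :: ('v, 'k) mpoly ring"
  show "abelian_group ?R"
  proof (rule abelian_groupI)
    fix p q :: "('v, 'k) mpoly" assume "p \<in> carrier ?R" "q \<in> carrier ?R"
    then show "p \<oplus>\<^bsub>?R\<^esub> q \<in> carrier ?R"
      using Poly_Mapping.keys_add[of p q] by (auto simp: mpoly_ring_def)
  next
    fix p :: "('v, 'k) mpoly" assume "p \<in> carrier ?R"
    then show "\<exists>q\<in>carrier ?R. q \<oplus>\<^bsub>?R\<^esub> p = \<zero>\<^bsub>?R\<^esub>"
      by (intro bexI[of _ "- p"]) (auto simp: mpoly_ring_def)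
  qed (auto simp: mpoly_ring_def algebra_simps)
  show "Group.comm_monoid ?R"
  proof (rule comm_monoidI)
    fix p q :: "('v, 'k) mpoly" assume pq: "p \<in> carrier ?R" "q \<in> carrier ?R"
    have "Poly_Mapping.keys c \<subseteq> V" if c: "c \<in> Poly_Mapping.keys (p * q)" for c
    proof -
      obtain a b where "c = a + b" "a \<in> Poly_Mapping.keys p" "b \<in> Poly_Mapping.keys q"
        using c Poly_Mapping.keys_mult[of p q] by blast
      then show ?thesis
        using pq Poly_Mapping.keys_add[of a b] by (fastforce simp: mpoly_ring_def)
    qed
    then show "p \<otimes>\<^bsub>?R\<^esub> q \<in> carrier ?R" by (auto simp: mpoly_ring_def)
  qed (auto simp: mpoly_ring_def algebra_simps)
qed (auto simp: mpoly_ring_def algebra_simps)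


section \<open>Edge ideals and normality\<close>

definition edge_ideal :: "'v clutter \<Rightarrow> ('v, 'k::field) mpoly set" where
  "edge_ideal C = Idl\<^bsub>mpoly_ring (verts C)\<^esub> ((\<lambda>e. \<Prod>x\<in>e. mpoly_var x) ` edges C)"

text \<open>Ideal powers are powers in the commutative monoid of ideals, so the zeroth power is the
  unit ideal.\<close>

definition ideal_pow :: "'v set \<Rightarrow> ('v, 'k::field) mpoly set \<Rightarrow> nat \<Rightarrow> ('v, 'k) mpoly set" where
  "ideal_pow V I i = I [^]\<^bsub>ideals_set (mpoly_ring V)\<^esub> i"

text \<open>The integral closure of the \<open>i\<close>-th power of a monomial ideal \<open>I\<close> of \<open>mpoly_ring V\<close>.\<close>

definition int_closure_pow ::
    "'v set \<Rightarrow> ('v, 'k::field) mpoly set \<Rightarrow> nat \<Rightarrow> ('v, 'k) mpoly set" where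
  "int_closure_pow V I i =
     Idl\<^bsub>mpoly_ring V\<^esub> {m \<in> monomials V.
       \<exists>p::nat. p \<ge> 1 \<and> m [^]\<^bsub>mpoly_ring V\<^esub> p \<in> ideal_pow V I (p * i)}"

definition normal_ideal :: "'v set \<Rightarrow> ('v, 'k::field) mpoly set \<Rightarrow> bool" where
  "normal_ideal V I \<longleftrightarrow> (\<forall>i\<ge>1. ideal_pow V I i = int_closure_pow V I i)"

end

theory Submission
  imports Defs
begin

text \<open>
  A monomial \<open>x\<^sup>a\<close> lies in \<open>I(C)\<^sup>i\<close> iff some \<open>i\<close> edges, repetitions allowed, can be packed
  into the exponent \<open>a\<close>; hence \<open>I(C)\<close> is normal iff the packing of \<open>p \<cdot> i\<close> edges into \<open>p \<cdot> a\<close>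
  for some \<open>p \<ge> 1\<close> forces the packing of \<open>i\<close> edges into \<open>a\<close>. A packing that avoids a deleted
  vertex uses only surviving edges. For a duplication of \<open>x\<close> as \<open>x'\<close>, identify \<open>x'\<close> with \<open>x\<close>
  and give \<open>x\<close> the capacity \<open>a x + a x'\<close>: packings in the two clutters then correspond to each
  other, because one may switch \<open>x\<close> to \<open>x'\<close> in as many of the edges through \<open>x\<close> as necessary.
\<close>

section \<open>Packings of edges\<close>

text \<open>For a list of finite edges this is the exponent of \<open>v\<close> in the product of
  their monomials.\<close>

definition occ :: "'v \<Rightarrow> 'v set list \<Rightarrow> nat" where
  "occ v es = length (filter (\<lambda>e. v \<in> e) es)"

lemma occ_Nil [simp]: "occ v [] = 0"
  and occ_Cons [simp]: "occ v (e # es) = of_bool (v \<in> e) + occ v es"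
  and occ_append [simp]: "occ v (es @ fs) = occ v es + occ v fs"
  by (simp_all add: occ_def)

text \<open>For finite edges: a product of \<open>i\<close> edge monomials divides the monomial with
  exponent \<open>a\<close>. Capacities are plain functions, so that they can be scaled and updated
  freely; finite support returns only with \<open>packing_exponents\<close>.\<close>

definition packs :: "'v set set \<Rightarrow> nat \<Rightarrow> ('v \<Rightarrow> nat) \<Rightarrow> bool" where
  "packs E i a \<longleftrightarrow> (\<exists>es. length es = i \<and> set es \<subseteq> E \<and> (\<forall>v. occ v es \<le> a v))"

lemma packs_0 [simp]: "packs E 0 a"
  by (simp add: packs_def)

lemma packs_mono: "packs E i a \<Longrightarrow> (\<And>v. a v \<le> b v) \<Longrightarrow> packs E i b"
  unfolding packs_def using le_trans by blast

lemma packs_add: "packs E i a \<Longrightarrow> packs E j b \<Longrightarrow> packs E (i + j) (\<lambda>v. a v + b v)"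
proof -
  assume "packs E i a" "packs E j b"
  then obtain es fs where "length es = i" "set es \<subseteq> E" "\<forall>v. occ v es \<le> a v"
    "length fs = j" "set fs \<subseteq> E" "\<forall>v. occ v fs \<le> b v"
    unfolding packs_def by blast
  then show ?thesis
    unfolding packs_def by (intro exI[of _ "es @ fs"]) (auto intro: add_mono)
qed

lemma packs_one: "packs E 1 a \<longleftrightarrow> (\<exists>e\<in>E. \<forall>v\<in>e. 1 \<le> a v)"
proof
  assume "packs E 1 a"
  then obtain es where es: "length es = Suc 0" "set es \<subseteq> E" "\<And>v. occ v es \<le> a v"
    by (auto simp: packs_def)
  then obtain e where "es = [e]" by (auto simp: length_Suc_conv)
  then have "1 \<le> a v" if "v \<in> e" for v using es(3)[of v] that by simp
  with es(2) \<open>es = [e]\<close> show "\<exists>e\<in>E. \<forall>v\<in>e. 1 \<le> a v" by auto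
next
  assume "\<exists>e\<in>E. \<forall>v\<in>e. 1 \<le> a v"
  then obtain e where "e \<in> E" "\<forall>v\<in>e. 1 \<le> a v" by blast
  then show "packs E 1 a"
    unfolding packs_def by (intro exI[of _ "[e]"]) auto
qed

lemma packs_SucE:
  assumes "packs E (Suc i) a"
  obtains e where "e \<in> E" "\<And>v. v \<in> e \<Longrightarrow> 1 \<le> a v" "packs E i (\<lambda>v. a v - of_bool (v \<in> e))"
proof -
  from assms obtain es where es: "length es = Suc i" "set es \<subseteq> E" "\<And>v. occ v es \<le> a v"
    by (auto simp: packs_def)
  then obtain e fs where [simp]: "es = e # fs" by (cases es) auto
  have le: "of_bool (v \<in> e) + occ v fs \<le> a v" for v using es(3)[of v] by simp
  show thesis
  proof
    show "e \<in> E" using es by simp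
    show "1 \<le> a v" if "v \<in> e" for v using le[of v] that by simp
    have "occ v fs \<le> a v - of_bool (v \<in> e)" for v using le[of v] by linarith
    then show "packs E i (\<lambda>v. a v - of_bool (v \<in> e))"
      unfolding packs_def using es by (intro exI[of _ fs]) auto
  qed
qed

lemma occ_outside: "set es \<subseteq> E \<Longrightarrow> E \<subseteq> Pow V \<Longrightarrow> v \<notin> V \<Longrightarrow> occ v es = 0"
  by (induction es) auto

text \<open>No edge meets the complement of \<open>V\<close>, so capacities there are irrelevant.
  This allows an arbitrary capacity to be cut down to a finitely supported one.\<close>

lemma packs_restrict:
  assumes "E \<subseteq> Pow V" "\<And>v. v \<in> V \<Longrightarrow> a v = b v" "packs E i a"
  shows "packs E i b"
proof -
  from assms(3) obtain es where es: "length es = i" "set es \<subseteq> E" "\<And>v. occ v es \<le> a v"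
    by (auto simp: packs_def)
  have "occ v es \<le> b v" for v
    using es(3)[of v] assms(2)[of v] occ_outside[OF es(2) assms(1), of v] by (cases "v \<in> V") auto
  with es show ?thesis unfolding packs_def by blast
qed

section \<open>Packing normality under deletion and duplication of a vertex\<close>

definition packing_normal :: "'v set set \<Rightarrow> bool" where
  "packing_normal E \<longleftrightarrow>
     (\<forall>i a. (\<exists>p\<ge>1. packs E (p * i) (\<lambda>v. p * a v)) \<longrightarrow> packs E i a)"

text \<open>Setting the capacity of \<open>x\<close> to 0 has the same effect as deleting
  \<open>x\<close>: it excludes exactly the edges through \<open>x\<close>.\<close>

lemma packing_normal_del:
  assumes "packing_normal (edges C)"
  shows "packing_normal (edges (del_vertex C x))"
  unfolding packing_normal_def
proof (intro allI impI, elim exE conjE)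
  fix i p :: nat and a :: "'a \<Rightarrow> nat"
  assume p: "p \<ge> 1" and "packs (edges (del_vertex C x)) (p * i) (\<lambda>v. p * a v)"
  then obtain es where es: "length es = p * i" "set es \<subseteq> edges (del_vertex C x)"
      "\<And>v. occ v es \<le> p * a v"
    by (auto simp: packs_def)
  have "occ x es = 0" using es(2) by (induction es) (auto simp: del_vertex_def)
  then have "occ v es \<le> p * (a(x := 0)) v" for v using es(3)[of v] by simp
  moreover have "set es \<subseteq> edges C" using es(2) by (auto simp: del_vertex_def)
  ultimately have "packs (edges C) (p * i) (\<lambda>v. p * (a(x := 0)) v)"
    unfolding packs_def using es(1) by blast
  then have "packs (edges C) i (a(x := 0))"
    using assms p unfolding packing_normal_def by blast
  then obtain fs where fs: "length fs = i" "set fs \<subseteq> edges C" "\<And>v. occ v fs \<le> (a(x := 0)) v"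
    by (auto simp: packs_def)
  \<comment> \<open>The zero capacity keeps the new packing away from \<open>x\<close>, so it
    survives the deletion.\<close>
  have "occ x fs = 0" using fs(3)[of x] by simp
  with fs(2) have "set fs \<subseteq> edges (del_vertex C x)"
    by (induction fs) (auto simp: del_vertex_def)
  moreover have "occ v fs \<le> a v" for v
    using fs(3)[of v] \<open>occ x fs = 0\<close> by (cases "v = x") auto
  ultimately show "packs (edges (del_vertex C x)) i a"
    unfolding packs_def using fs(1) by blast
qed

text \<open>Replace every copied edge by an original one. The copy contains \<open>x'\<close> but
  not \<open>x\<close>, and the original contains \<open>x\<close> but not \<open>x'\<close>, so the
  two counts add up at \<open>x\<close>.\<close>

lemma merge_copies:
  assumes "edges C \<subseteq> Pow (verts C)" "x \<in> verts C" "x' \<notin> verts C"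
    and "set es \<subseteq> edges (dup_vertex C x x')"
  shows "\<exists>fs. length fs = length es \<and> set fs \<subseteq> edges C \<and> occ x' fs = 0 \<and>
           occ x fs = occ x es + occ x' es \<and> (\<forall>v. v \<noteq> x \<longrightarrow> v \<noteq> x' \<longrightarrow> occ v fs = occ v es)"
  using assms(4)
proof (induction es)
  case (Cons e es)
  then obtain fs where fs: "length fs = length es" "set fs \<subseteq> edges C" "occ x' fs = 0"
    "occ x fs = occ x es + occ x' es" "\<And>v. v \<noteq> x \<Longrightarrow> v \<noteq> x' \<Longrightarrow> occ v fs = occ v es"
    by auto
  have ne: "x \<noteq> x'" using assms by blast
  from Cons.prems consider "e \<in> edges C"
    | f where "f \<in> edges C" "x \<in> f" "e = insert x' (f - {x})"
    by (auto simp: dup_vertex_def)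
  then show ?case
  proof cases
    case 1
    then have "x' \<notin> e" using assms by blast
    with 1 fs show ?thesis by (intro exI[of _ "e # fs"]) auto
  next
    case 2
    then have "x' \<notin> f" using assms by blast
    with 2 fs ne show ?thesis by (intro exI[of _ "f # fs"]) auto
  qed
qed simp

text \<open>A greedy choice: an edge through \<open>x\<close> stays as it is while the budget
  \<open>k\<close> lasts; once \<open>k\<close> is 0, it is replaced by its copy at the expense of
  \<open>l\<close>.\<close>

lemma split_copies:
  assumes "edges C \<subseteq> Pow (verts C)" "x \<in> verts C" "x' \<notin> verts C"
    and "set fs \<subseteq> edges C" "occ x fs \<le> k + l"
  shows "\<exists>es. length es = length fs \<and> set es \<subseteq> edges (dup_vertex C x x') \<and>
           occ x es \<le> k \<and> occ x' es \<le> l \<and> (\<forall>v. v \<noteq> x \<longrightarrow> v \<noteq> x' \<longrightarrow> occ v es = occ v fs)"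
  using assms(4,5)
proof (induction fs arbitrary: k l)
  case (Cons f fs)
  have f: "f \<in> edges C" and fs: "set fs \<subseteq> edges C" and x': "x' \<notin> f" and ne: "x \<noteq> x'"
    using Cons.prems assms(1-3) by auto
  have f_dup: "f \<in> edges (dup_vertex C x x')" using f by (simp add: dup_vertex_def)
  \<comment> \<open>If \<open>x\<close> lies in \<open>f\<close>, then \<open>k + l\<close> is
    positive, so some budget is left.\<close>
  consider "x \<notin> f" | k' where "x \<in> f" "k = Suc k'" | l' where "x \<in> f" "k = 0" "l = Suc l'"
    using Cons.prems(2) by (cases k; cases l) auto
  then show ?case
  proof cases
    case 1
    then have "occ x fs \<le> k + l" using Cons.prems by simp
    from Cons.IH[OF fs this] obtain es where "length es = length fs"
      "set es \<subseteq> edges (dup_vertex C x x')" "occ x es \<le> k" "occ x' es \<le> l"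
      "\<forall>v. v \<noteq> x \<longrightarrow> v \<noteq> x' \<longrightarrow> occ v es = occ v fs" by blast
    with 1 f_dup x' show ?thesis by (intro exI[of _ "f # es"]) auto
  next
    case 2
    then have "occ x fs \<le> k' + l" using Cons.prems by simp
    from Cons.IH[OF fs this] obtain es where "length es = length fs"
      "set es \<subseteq> edges (dup_vertex C x x')" "occ x es \<le> k'" "occ x' es \<le> l"
      "\<forall>v. v \<noteq> x \<longrightarrow> v \<noteq> x' \<longrightarrow> occ v es = occ v fs" by blast
    with 2 f_dup x' show ?thesis by (intro exI[of _ "f # es"]) auto
  next
    case 3
    then have "occ x fs \<le> 0 + l'" using Cons.prems by simp
    from Cons.IH[OF fs this] obtain es where "length es = length fs"
      "set es \<subseteq> edges (dup_vertex C x x')" "occ x es \<le> 0" "occ x' es \<le> l'"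
      "\<forall>v. v \<noteq> x \<longrightarrow> v \<noteq> x' \<longrightarrow> occ v es = occ v fs" by blast
    moreover have "insert x' (f - {x}) \<in> edges (dup_vertex C x x')"
      using f 3 by (auto simp: dup_vertex_def)
    ultimately show ?thesis
      using 3 ne by (intro exI[of _ "insert x' (f - {x}) # es"]) auto
  qed
qed simp

lemma packing_normal_dup:
  assumes C: "edges C \<subseteq> Pow (verts C)" "x \<in> verts C" "x' \<notin> verts C"
    and normal: "packing_normal (edges C)"
  shows "packing_normal (edges (dup_vertex C x x'))"
  unfolding packing_normal_def
proof (intro allI impI, elim exE conjE)
  fix i p :: nat and a :: "'a \<Rightarrow> nat"
  \<comment> \<open>Capacity 0 at \<open>x'\<close> costs nothing, since no edge of \<open>C\<close>
    contains the fresh vertex.\<close>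
  let ?b = "a(x := a x + a x', x' := 0)"
  have ne: "x \<noteq> x'" using C by blast
  assume p: "p \<ge> 1" and "packs (edges (dup_vertex C x x')) (p * i) (\<lambda>v. p * a v)"
  then obtain es where es: "length es = p * i" "set es \<subseteq> edges (dup_vertex C x x')"
      "\<And>v. occ v es \<le> p * a v"
    by (auto simp: packs_def)
  from merge_copies[OF C es(2)] obtain fs where fs: "length fs = length es"
    "set fs \<subseteq> edges C" "occ x' fs = 0" "occ x fs = occ x es + occ x' es"
    "\<And>v. v \<noteq> x \<Longrightarrow> v \<noteq> x' \<Longrightarrow> occ v fs = occ v es" by blast
  \<comment> \<open>At \<open>x\<close> the bounds for \<open>x\<close> and \<open>x'\<close> are
    added: \<open>p * a x + p * a x' = p * (a x + a x')\<close>.\<close>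
  have "occ v fs \<le> p * ?b v" for v
    using fs(3,4) fs(5)[of v] es(3)[of v] es(3)[of x] es(3)[of x'] ne
    by (auto simp: add_mult_distrib2)
  then have "packs (edges C) (p * i) (\<lambda>v. p * ?b v)"
    unfolding packs_def using fs(1,2) es(1) by metis
  then have "packs (edges C) i ?b"
    using normal p unfolding packing_normal_def by blast
  then obtain gs where gs: "length gs = i" "set gs \<subseteq> edges C" "\<And>v. occ v gs \<le> ?b v"
    by (auto simp: packs_def)
  have "occ x gs \<le> a x + a x'" using gs(3)[of x] ne by simp
  from split_copies[OF C gs(2) this] obtain hs where hs: "length hs = length gs"
    "set hs \<subseteq> edges (dup_vertex C x x')" "occ x hs \<le> a x" "occ x' hs \<le> a x'"
    "\<And>v. v \<noteq> x \<Longrightarrow> v \<noteq> x' \<Longrightarrow> occ v hs = occ v gs" by blast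
  have "occ v hs \<le> a v" for v
    using hs(3,4) hs(5)[of v] gs(3)[of v] by (cases "v = x"; cases "v = x'") auto
  then show "packs (edges (dup_vertex C x x')) i a"
    unfolding packs_def using hs gs(1) by metis
qed

section \<open>Monomial ideals as sets of exponents\<close>

text \<open>The \<open>K\<close>-linear span of the monomials with exponents in \<open>A\<close>.
  Monomial ideals have this form, which reduces their equality to equality of exponent sets.\<close>

definition monomial_span :: "('v \<Rightarrow>\<^sub>0 nat) set \<Rightarrow> ('v, 'k::field) mpoly set" where
  "monomial_span A = {p. Poly_Mapping.keys p \<subseteq> A}"

text \<open>A semigroup ideal of the exponent vectors supported in \<open>V\<close>: the set of
  exponents of the monomials of a monomial ideal.\<close>

definition exponent_ideal :: "'v set \<Rightarrow> ('v \<Rightarrow>\<^sub>0 nat) set \<Rightarrow> bool" where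
  "exponent_ideal V A \<longleftrightarrow> (\<forall>a\<in>A. Poly_Mapping.keys a \<subseteq> V) \<and>
     (\<forall>a\<in>A. \<forall>b. Poly_Mapping.keys b \<subseteq> V \<longrightarrow> a + b \<in> A)"

lemma single_in_monomial_span [simp]:
  "Poly_Mapping.single a (1::'k::field) \<in> monomial_span A \<longleftrightarrow> a \<in> A"
  by (simp add: monomial_span_def)

lemma monomial_span_inject:
  "(monomial_span A :: ('v, 'k::field) mpoly set) = monomial_span B \<longleftrightarrow> A = B"
  by (metis single_in_monomial_span subsetI subset_antisym)

text \<open>A polynomial is the finite sum of its terms, so an additively closed set containing 0
  and all terms over \<open>A\<close> contains the whole span.\<close>

lemma monomial_span_subset:
  fixes J :: "('v, 'k::field) mpoly set"
  assumes "0 \<in> J" "\<And>p q. p \<in> J \<Longrightarrow> q \<in> J \<Longrightarrow> p + q \<in> J"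
    and "\<And>a c. a \<in> A \<Longrightarrow> Poly_Mapping.single a c \<in> J"
  shows "monomial_span A \<subseteq> J"
proof
  fix p :: "('v, 'k) mpoly"
  assume "p \<in> monomial_span A"
  then have "Poly_Mapping.keys p \<subseteq> A" by (simp add: monomial_span_def)
  moreover have "p = (\<Sum>a\<in>Poly_Mapping.keys p. Poly_Mapping.single a (Poly_Mapping.lookup p a))"
    by (rule poly_mapping_eqI)
      (auto simp: lookup_sum lookup_single when_def in_keys_iff)
  moreover have "(\<Sum>a\<in>B. Poly_Mapping.single a (Poly_Mapping.lookup p a)) \<in> J"
    if "finite B" "B \<subseteq> A" for B
    using that by (induction B) (auto intro: assms)
  ultimately show "p \<in> J" by (metis finite_keys)
qed

lemma ideal_monomial_span:
  assumes "exponent_ideal V A"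
  shows "ideal (monomial_span A :: ('v, 'k::field) mpoly set) (mpoly_ring V)"
proof -
  interpret cring "mpoly_ring V :: ('v, 'k) mpoly ring" by (rule cring_mpoly_ring)
  have mult: "q * p \<in> monomial_span A"
    if p: "p \<in> monomial_span A" and q: "q \<in> carrier (mpoly_ring V)" for p q :: "('v, 'k) mpoly"
  proof -
    have "c \<in> A" if c_key: "c \<in> Poly_Mapping.keys (q * p)" for c
    proof -
      obtain b a where c: "c = b + a" "b \<in> Poly_Mapping.keys q" "a \<in> Poly_Mapping.keys p"
        using c_key keys_mult[of q p] by blast
      then show ?thesis
        using p q assms
        by (auto simp: exponent_ideal_def monomial_span_def mpoly_ring_def add.commute)
    qed
    then show ?thesis by (auto simp: monomial_span_def)
  qed
  show ?thesis
  proof (rule idealI)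
    show "subgroup (monomial_span A) (add_monoid (mpoly_ring V :: ('v, 'k) mpoly ring))"
    proof (rule add.subgroupI)
      show sub: "monomial_span A \<subseteq> carrier (mpoly_ring V :: ('v, 'k) mpoly ring)"
        using assms by (auto simp: exponent_ideal_def monomial_span_def mpoly_ring_def)
      show "(monomial_span A :: ('v, 'k) mpoly set) \<noteq> {}"
        by (auto simp: monomial_span_def intro!: exI[of _ 0])
      fix p q :: "('v, 'k) mpoly"
      assume p: "p \<in> monomial_span A"
      have carr: "- p \<in> carrier (mpoly_ring V)" "p \<in> carrier (mpoly_ring V)"
        using p sub by (auto simp: mpoly_ring_def)
      \<comment> \<open>The inverse in the ring structure is identified with the negation of the
        type by uniqueness of inverses.\<close>
      have "\<ominus>\<^bsub>mpoly_ring V\<^esub> p = - p"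
        by (rule minus_equality) (use carr in \<open>auto simp: mpoly_ring_def\<close>)
      then show "\<ominus>\<^bsub>mpoly_ring V\<^esub> p \<in> monomial_span A"
        using p by (simp add: monomial_span_def)
      assume "q \<in> monomial_span A"
      then show "p \<oplus>\<^bsub>mpoly_ring V\<^esub> q \<in> monomial_span A"
        using p keys_add[of p q] by (auto simp: monomial_span_def mpoly_ring_def)
    qed
  next
    fix p q :: "('v, 'k) mpoly"
    assume "p \<in> monomial_span A" "q \<in> carrier (mpoly_ring V)"
    from mult[OF this] show "q \<otimes>\<^bsub>mpoly_ring V\<^esub> p \<in> monomial_span A"
      and "p \<otimes>\<^bsub>mpoly_ring V\<^esub> q \<in> monomial_span A"
      by (simp_all add: mpoly_ring_def mult.commute)
  qed (rule ring_axioms)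
qed

text \<open>Every monomial over \<open>A\<close> is a multiple of a generator, and a coefficient can
  be moved into the cofactor.\<close>

lemma genideal_monomials:
  assumes A: "exponent_ideal V A" and "G \<subseteq> A"
    and "\<And>a. a \<in> A \<Longrightarrow> \<exists>g\<in>G. \<exists>b. a = g + b"
  shows "Idl\<^bsub>mpoly_ring V\<^esub> ((\<lambda>a. Poly_Mapping.single a 1) ` G) =
    (monomial_span A :: ('v, 'k::field) mpoly set)"
    (is "?I = _")
proof
  interpret cring "mpoly_ring V :: ('v, 'k) mpoly ring" by (rule cring_mpoly_ring)
  show "?I \<subseteq> monomial_span A"
    by (rule genideal_minimal[OF ideal_monomial_span[OF A]]) (use \<open>G \<subseteq> A\<close> in auto)
  have "G \<subseteq> {a. Poly_Mapping.keys a \<subseteq> V}"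
    using A \<open>G \<subseteq> A\<close> by (auto simp: exponent_ideal_def)
  then have carr: "(\<lambda>a. Poly_Mapping.single a 1) ` G \<subseteq> carrier (mpoly_ring V :: ('v, 'k) mpoly ring)"
    by (auto simp: mpoly_ring_def)
  interpret I: ideal ?I "mpoly_ring V" by (rule genideal_ideal[OF carr])
  show "monomial_span A \<subseteq> ?I"
  proof (rule monomial_span_subset)
    show "0 \<in> ?I" using I.zero_closed by (simp add: mpoly_ring_def)
    show "p + q \<in> ?I" if "p \<in> ?I" "q \<in> ?I" for p q
      using I.a_closed[OF that] by (simp add: mpoly_ring_def)
    fix a and c :: 'k
    assume "a \<in> A"
    then obtain g b where g: "g \<in> G" "a = g + b" using assms(3) by blast
    \<comment> \<open>Natural exponents cannot cancel in \<open>g + b\<close>, so the cofactor uses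
      only variables in \<open>V\<close>.\<close>
    have "Poly_Mapping.keys b \<subseteq> Poly_Mapping.keys a"
      using g(2) by (auto simp: in_keys_iff lookup_add)
    with \<open>a \<in> A\<close> A have "Poly_Mapping.single b c \<in> carrier (mpoly_ring V)"
      by (auto simp: exponent_ideal_def mpoly_ring_def)
    moreover have "Poly_Mapping.single g 1 \<in> ?I"
      using genideal_self[OF carr] g(1) by blast
    ultimately have "Poly_Mapping.single g 1 \<otimes>\<^bsub>mpoly_ring V\<^esub> Poly_Mapping.single b c \<in> ?I"
      using I.I_r_closed by blast
    then show "Poly_Mapping.single a c \<in> ?I"
      by (simp add: mpoly_ring_def mult_single g(2))
  qed
qed

text \<open>Terms of a product have exponents \<open>a + b\<close>, and cancellation only removes
  terms. Conversely, each term with exponent \<open>a + b\<close> is itself a product of two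
  terms.\<close>

lemma ideal_prod_monomial_span:
  assumes "exponent_ideal V A" "exponent_ideal V B"
  shows "ideal_prod (mpoly_ring V) (monomial_span A) (monomial_span B) =
    (monomial_span {a + b | a b. a \<in> A \<and> b \<in> B} :: ('v, 'k::field) mpoly set)"
    (is "?P = monomial_span ?S")
proof
  interpret cring "mpoly_ring V :: ('v, 'k) mpoly ring" by (rule cring_mpoly_ring)
  interpret P: ideal ?P "mpoly_ring V"
    by (rule ideal_prod_is_ideal; rule ideal_monomial_span; fact)
  show "?P \<subseteq> monomial_span ?S"
  proof
    fix p assume "p \<in> ?P"
    then show "p \<in> monomial_span ?S"
    proof (induction rule: ideal_prod.induct)
      case (prod p q)
      then show ?case
        using keys_mult[of p q] by (fastforce simp: mpoly_ring_def monomial_span_def)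
    next
      case (sum p q)
      then show ?case
        using keys_add[of p q] by (auto simp: mpoly_ring_def monomial_span_def)
    qed
  qed
  show "monomial_span ?S \<subseteq> ?P"
  proof (rule monomial_span_subset)
    show "0 \<in> ?P" using P.zero_closed by (simp add: mpoly_ring_def)
    show "p + q \<in> ?P" if "p \<in> ?P" "q \<in> ?P" for p q
      using P.a_closed[OF that] by (simp add: mpoly_ring_def)
    fix s and c :: 'k
    assume "s \<in> ?S"
    then obtain a b where ab: "s = a + b" "a \<in> A" "b \<in> B" by blast
    have "Poly_Mapping.single a c \<otimes>\<^bsub>mpoly_ring V\<^esub> Poly_Mapping.single b 1 \<in> ?P"
      by (rule ideal_prod.prod) (use ab in \<open>auto simp: monomial_span_def\<close>)
    then show "Poly_Mapping.single s c \<in> ?P"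
      by (simp add: mpoly_ring_def mult_single ab(1))
  qed
qed

section \<open>Normality of edge ideals\<close>

definition packing_exponents :: "'v clutter \<Rightarrow> nat \<Rightarrow> ('v \<Rightarrow>\<^sub>0 nat) set" where
  "packing_exponents C i =
     {a. Poly_Mapping.keys a \<subseteq> verts C \<and> packs (edges C) i (Poly_Mapping.lookup a)}"

definition closure_exponents :: "'v clutter \<Rightarrow> nat \<Rightarrow> ('v \<Rightarrow>\<^sub>0 nat) set" where
  "closure_exponents C i =
     {a. Poly_Mapping.keys a \<subseteq> verts C \<and>
       (\<exists>p\<ge>1. packs (edges C) (p * i) (\<lambda>v. p * Poly_Mapping.lookup a v))}"

lemma keys_add_subset:
  "Poly_Mapping.keys a \<subseteq> V \<Longrightarrow> Poly_Mapping.keys b \<subseteq> V \<Longrightarrow> Poly_Mapping.keys (a + b) \<subseteq> V"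
  using keys_add[of a b] by blast

lemma exponent_ideal_packing: "exponent_ideal (verts C) (packing_exponents C i)"
  unfolding exponent_ideal_def packing_exponents_def
  by (auto simp: lookup_add dest: keys_add_subset[THEN subsetD, rotated 2] elim: packs_mono)

text \<open>The same \<open>p\<close> serves for \<open>a\<close> and for \<open>a + b\<close>, as
  \<open>p * a\<close> is at most \<open>p * (a + b)\<close>.\<close>

lemma exponent_ideal_closure: "exponent_ideal (verts C) (closure_exponents C i)"
  unfolding exponent_ideal_def closure_exponents_def
  by (auto simp: lookup_add add_mult_distrib2
      dest: keys_add_subset[THEN subsetD, rotated 2] elim!: packs_mono intro!: exI)

text \<open>For finite \<open>e\<close> this is the characteristic vector of \<open>e\<close>, the
  exponent of its edge monomial.\<close>

definition edge_exponent :: "'v set \<Rightarrow> ('v \<Rightarrow>\<^sub>0 nat)" where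
  "edge_exponent e = (\<Sum>x\<in>e. Poly_Mapping.single x 1)"

lemma lookup_edge_exponent:
  "finite e \<Longrightarrow> Poly_Mapping.lookup (edge_exponent e) v = of_bool (v \<in> e)"
  by (auto simp: edge_exponent_def lookup_sum lookup_single when_def)

lemma keys_edge_exponent: "finite e \<Longrightarrow> Poly_Mapping.keys (edge_exponent e) = e"
  by (auto simp: in_keys_iff lookup_edge_exponent)

lemma prod_mpoly_var:
  "(\<Prod>x\<in>e. mpoly_var x :: ('v, 'k::field) mpoly) = Poly_Mapping.single (edge_exponent e) 1"
  \<comment> \<open>For infinite \<open>e\<close> the product defaults to 1 and the sum to 0, and
    the monomial with exponent 0 is 1.\<close>
  by (induction e rule: infinite_finite_induct)
    (simp_all add: edge_exponent_def mpoly_var_def mult_single)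

lemma packing_exponents_SucE:
  assumes "\<And>e. e \<in> edges C \<Longrightarrow> finite e" "a \<in> packing_exponents C (Suc i)"
  obtains e b where "e \<in> edges C" "b \<in> packing_exponents C i" "a = edge_exponent e + b"
proof -
  from assms(2) have a: "Poly_Mapping.keys a \<subseteq> verts C"
      "packs (edges C) (Suc i) (Poly_Mapping.lookup a)"
    by (auto simp: packing_exponents_def)
  from a(2) obtain e where e: "e \<in> edges C" "\<And>v. v \<in> e \<Longrightarrow> 1 \<le> Poly_Mapping.lookup a v"
      "packs (edges C) i (\<lambda>v. Poly_Mapping.lookup a v - of_bool (v \<in> e))"
    using packs_SucE by metis
  \<comment> \<open>The truncated subtraction is exact, because \<open>a\<close> is at least 1 on
    \<open>e\<close>.\<close>
  let ?b = "a - edge_exponent e"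
  have look: "Poly_Mapping.lookup ?b = (\<lambda>v. Poly_Mapping.lookup a v - of_bool (v \<in> e))"
    using assms(1)[OF e(1)] by (auto simp: lookup_minus lookup_edge_exponent)
  show thesis
  proof
    show "?b \<in> packing_exponents C i"
      using e(3) a(1) by (auto simp: packing_exponents_def look in_keys_iff)
    show "a = edge_exponent e + ?b"
      by (rule poly_mapping_eqI)
        (use e(2) assms(1)[OF e(1)] in \<open>auto simp: lookup_add look lookup_edge_exponent\<close>)
  qed (rule e(1))
qed

lemma edge_exponent_in_packing:
  assumes "e \<in> edges C" "e \<subseteq> verts C" "finite e"
  shows "edge_exponent e \<in> packing_exponents C 1"
  using assms
  by (auto simp: packing_exponents_def packs_one[unfolded One_nat_def] keys_edge_exponent
      lookup_edge_exponent intro!: bexI[of _ e])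

lemma packing_exponents_Suc:
  assumes "\<And>e. e \<in> edges C \<Longrightarrow> finite e" "edges C \<subseteq> Pow (verts C)"
  shows "packing_exponents C (Suc i) =
    {a + b | a b. a \<in> packing_exponents C i \<and> b \<in> packing_exponents C 1}" (is "_ = ?S")
proof
  show "packing_exponents C (Suc i) \<subseteq> ?S"
  proof
    fix a assume "a \<in> packing_exponents C (Suc i)"
    then obtain e b where "e \<in> edges C" "b \<in> packing_exponents C i" "a = edge_exponent e + b"
      using packing_exponents_SucE assms(1) by blast
    moreover from this have "edge_exponent e \<in> packing_exponents C 1"
      using assms by (intro edge_exponent_in_packing) auto
    ultimately show "a \<in> ?S" by (auto simp: add.commute)
  qed
  show "?S \<subseteq> packing_exponents C (Suc i)"
  proof clarify
    fix a b assume "a \<in> packing_exponents C i" "b \<in> packing_exponents C 1"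
    then show "a + b \<in> packing_exponents C (Suc i)"
      using packs_add[of "edges C" i "Poly_Mapping.lookup a" 1 "Poly_Mapping.lookup b"]
        keys_add_subset[of a "verts C" b]
      by (simp add: packing_exponents_def plus_poly_mapping.rep_eq)
  qed
qed

lemma edge_ideal_eq_monomial_span:
  assumes "\<And>e. e \<in> edges C \<Longrightarrow> finite e" "edges C \<subseteq> Pow (verts C)"
  shows "edge_ideal C = (monomial_span (packing_exponents C 1) :: ('v, 'k::field) mpoly set)"
proof -
  have "edge_ideal C = Idl\<^bsub>mpoly_ring (verts C)\<^esub>
      ((\<lambda>a. Poly_Mapping.single a (1::'k)) ` edge_exponent ` edges C)"
    by (simp add: edge_ideal_def prod_mpoly_var image_image)
  also have "\<dots> = monomial_span (packing_exponents C 1)"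
  proof (rule genideal_monomials[OF exponent_ideal_packing])
    show "edge_exponent ` edges C \<subseteq> packing_exponents C 1"
      using assms by (auto intro: edge_exponent_in_packing simp del: One_nat_def)
    \<comment> \<open>Peeling the only edge off a packing of size 1 gives the generator that divides
      the monomial.\<close>
    show "\<exists>g\<in>edge_exponent ` edges C. \<exists>b. a = g + b" if "a \<in> packing_exponents C 1" for a
      using that packing_exponents_SucE[of C a 0] assms(1) by (metis One_nat_def imageI)
  qed
  finally show ?thesis .
qed

section \<open>Powers of the edge ideal and their integral closures\<close>

lemma ideal_pow_edge_ideal:
  assumes "\<And>e. e \<in> edges C \<Longrightarrow> finite e" "edges C \<subseteq> Pow (verts C)"
  shows "ideal_pow (verts C) (edge_ideal C) i =
    (monomial_span (packing_exponents C i) :: ('v, 'k::field) mpoly set)"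
proof (induction i)
  case 0
  \<comment> \<open>The zeroth power is the whole ring, and the empty packing fits into every
    exponent.\<close>
  show ?case
    by (auto simp: ideal_pow_def nat_pow_def ideals_set_def mpoly_ring_def monomial_span_def
        packing_exponents_def)
next
  case (Suc i)
  have "ideal_pow (verts C) (edge_ideal C) (Suc i) = ideal_prod (mpoly_ring (verts C))
      (ideal_pow (verts C) (edge_ideal C) i) (edge_ideal C :: ('v, 'k) mpoly set)"
    by (simp add: ideal_pow_def nat_pow_def ideals_set_def)
  also have "\<dots> = monomial_span (packing_exponents C (Suc i))"
    unfolding Suc.IH
    by (simp only: edge_ideal_eq_monomial_span[OF assms]
        ideal_prod_monomial_span[OF exponent_ideal_packing exponent_ideal_packing]
        packing_exponents_Suc[OF assms])
  finally show ?case .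
qed

lemma single_nat_pow:
  "Poly_Mapping.single a (1::'k::field) [^]\<^bsub>mpoly_ring V\<^esub> (p::nat) =
    Poly_Mapping.single (\<Sum>_<p. a) 1"
proof (induction p)
  case 0
  show ?case by (simp add: nat_pow_def mpoly_ring_def)
next
  case (Suc p)
  then show ?case by (simp add: nat_pow_def mpoly_ring_def mult_single add.commute)
qed

lemma int_closure_pow_edge_ideal:
  assumes "\<And>e. e \<in> edges C \<Longrightarrow> finite e" "edges C \<subseteq> Pow (verts C)"
  shows "int_closure_pow (verts C) (edge_ideal C) i =
    (monomial_span (closure_exponents C i) :: ('v, 'k::field) mpoly set)"
proof -
  have pow: "Poly_Mapping.single a (1::'k) [^]\<^bsub>mpoly_ring (verts C)\<^esub> p
      \<in> ideal_pow (verts C) (edge_ideal C) (p * i) \<longleftrightarrow>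
    packs (edges C) (p * i) (\<lambda>v. p * Poly_Mapping.lookup a v)"
    if "Poly_Mapping.keys a \<subseteq> verts C" for a and p :: nat
  proof -
    have look: "Poly_Mapping.lookup (\<Sum>_<p. a) = (\<lambda>v. p * Poly_Mapping.lookup a v)"
      by (rule ext) (simp add: lookup_sum)
    have "Poly_Mapping.keys (\<Sum>_<p. a) \<subseteq> verts C"
      using that by (auto simp: in_keys_iff look)
    then show ?thesis
      by (simp only: single_nat_pow ideal_pow_edge_ideal[OF assms] single_in_monomial_span
          packing_exponents_def mem_Collect_eq look simp_thms)
  qed
  have "{m \<in> monomials (verts C). \<exists>p::nat. p \<ge> 1 \<and> m [^]\<^bsub>mpoly_ring (verts C)\<^esub> p
        \<in> ideal_pow (verts C) (edge_ideal C) (p * i)} =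
      (\<lambda>a. Poly_Mapping.single a (1::'k)) ` closure_exponents C i"
    unfolding monomials_def closure_exponents_def using pow by blast
  moreover have "Idl\<^bsub>mpoly_ring (verts C)\<^esub>
      ((\<lambda>a. Poly_Mapping.single a (1::'k)) ` closure_exponents C i) =
      monomial_span (closure_exponents C i)"
    \<comment> \<open>The exponents of the generators already form an exponent ideal, so each one
      serves as its own generator, with cofactor exponent 0.\<close>
    by (rule genideal_monomials[OF exponent_ideal_closure])
      (auto intro!: bexI exI[of _ 0])
  ultimately show ?thesis by (simp only: int_closure_pow_def)
qed

text \<open>Beyond comparing exponent sets, two gaps are bridged: \<open>packing_normal\<close> also
  covers \<open>i = 0\<close>, and it ranges over all functions instead of exponents supported in
  \<open>verts C\<close>. Its formulation involves neither the field nor the ring.\<close>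

lemma normal_edge_ideal_iff:
  assumes C: "is_clutter C"
  shows "normal_ideal (verts C) (edge_ideal C :: ('v, 'k::field) mpoly set) \<longleftrightarrow>
    packing_normal (edges C)"
proof -
  have sub: "edges C \<subseteq> Pow (verts C)" and fin_V: "finite (verts C)"
    using C by (auto simp: is_clutter_def)
  then have fin: "\<And>e. e \<in> edges C \<Longrightarrow> finite e" by (auto intro: finite_subset)
  have "normal_ideal (verts C) (edge_ideal C :: ('v, 'k) mpoly set) \<longleftrightarrow>
      (\<forall>i\<ge>1. packing_exponents C i = closure_exponents C i)"
    by (simp only: normal_ideal_def ideal_pow_edge_ideal[OF fin sub]
        int_closure_pow_edge_ideal[OF fin sub] monomial_span_inject)
  also have "\<dots> \<longleftrightarrow> packing_normal (edges C)"
  proof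
    assume *: "packing_normal (edges C)"
    have "packing_exponents C i \<subseteq> closure_exponents C i" for i
      \<comment> \<open>A power is contained in its integral closure, with witness
        \<open>p = 1\<close>.\<close>
      unfolding packing_exponents_def closure_exponents_def by (auto intro!: exI[of _ "Suc 0"])
    moreover have "closure_exponents C i \<subseteq> packing_exponents C i" for i
      using * unfolding packing_exponents_def closure_exponents_def packing_normal_def by blast
    ultimately show "\<forall>i\<ge>1. packing_exponents C i = closure_exponents C i" by blast
  next
    assume *: "\<forall>i\<ge>1. packing_exponents C i = closure_exponents C i"
    show "packing_normal (edges C)"
      unfolding packing_normal_def
    proof (intro allI impI, elim exE conjE)
      fix i p :: nat and a :: "'v \<Rightarrow> nat"
      assume p: "p \<ge> 1" "packs (edges C) (p * i) (\<lambda>v. p * a v)"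
      \<comment> \<open>Cutting \<open>a\<close> off outside the finite vertex set turns it into an
        exponent vector and keeps its values on all edges.\<close>
      define b where "b = Abs_poly_mapping (\<lambda>v. if v \<in> verts C then a v else 0)"
      have b: "Poly_Mapping.lookup b = (\<lambda>v. if v \<in> verts C then a v else 0)"
        unfolding b_def by (rule lookup_Abs_poly_mapping) (use fin_V in simp)
      have "packs (edges C) (p * i) (\<lambda>v. p * Poly_Mapping.lookup b v)"
        by (rule packs_restrict[OF sub _ p(2)]) (simp add: b)
      moreover have "Poly_Mapping.keys b \<subseteq> verts C" by (auto simp: in_keys_iff b split: if_splits)
      ultimately have "b \<in> closure_exponents C i"
        using p(1) by (auto simp: closure_exponents_def)
      then have "packs (edges C) i (Poly_Mapping.lookup b)"
        \<comment> \<open>The hypothesis starts at \<open>i = 1\<close>; for \<open>i = 0\<close>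
          the empty packing suffices.\<close>
        using * by (cases i) (auto simp: packing_exponents_def)
      then show "packs (edges C) i a"
        by (rule packs_restrict[OF sub, rotated]) (simp add: b)
    qed
  qed
  finally show ?thesis .
qed

theorem theorem2p3:
  fixes C C' :: "'v clutter"
  assumes "is_clutter C"
    and "verts C \<noteq> {}"
    and "\<Union> (edges C) = verts C"
    and "parallelization C C'"
    and "normal_ideal (verts C) (edge_ideal C :: ('v, 'k::field) mpoly set)"
  shows "normal_ideal (verts C') (edge_ideal C' :: ('v, 'k) mpoly set)"
proof -
  \<comment> \<open>The induction runs on packings, since the polynomial ring changes with each
    deletion or duplication.\<close>
  have "packing_normal (edges C')"
    using assms(4)
  proof induction
    case refl
    show ?case using assms(1,5) normal_edge_ideal_iff by blast
  next
    case (del D x)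
    then show ?case by (simp add: packing_normal_del)
  next
    case (dup D x x')
    \<comment> \<open>Edges of \<open>D\<close> consist of vertices of \<open>D\<close>, so the new
      vertex \<open>x'\<close> lies in none of them, as the duplication step requires.\<close>
    have "is_clutter D" using parallelization_is_clutter[OF dup.hyps(1) assms(1)] .
    then show ?case using dup by (intro packing_normal_dup) (auto simp: is_clutter_def)
  qed
  then show ?thesis
    using normal_edge_ideal_iff parallelization_is_clutter[OF assms(4,1)] by blast
qed

end
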